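(* Take any function $\mathsf s\colon[0,\infty]\to[-\infty,\infty]$ and any non-atomic finite nonnegative measure $\nu$ on $\mathcal B(\mathbb R)$. Let $m_\nu:=G_\nu(\infty)$. Then the following two conditions are equivalent to each other: (I) there exists a non-atomic zero-mean probability measure $\mu$ on $\mathcal B(\mathbb R)$ such that $\mu_+=\nu$ and the restriction of $\mathsf r_\mu$ to $[0,\infty]$ equals $\mathsf s$; (II) all of the following conditions hold: - $\mathsf s(0)=0$; - $\mathsf s$ is nonincreasing on $[0,\infty]$; - $\mathsf s$ is left-continuous on $(0,\infty]$; - $\nu\big((-\infty,0)\big)=0$; - $m_\nu<\infty$; - if $x\in[0,\infty)$ and $G_\nu(x)<m_\nu$, then $\mathsf s(x)>-\infty$; - if $x\in(0,\infty]$ and $G_\nu(x)>0$, then $\mathsf s(x)<0$; - if $0\le x<y\le\infty$, then $\nu\big((x,y)\big)=0\iff\mathsf s(x)=\mathsf s(y)$; - $\displaystyle\int_{(0,\infty)}\Big(1-\frac x{\mathsf s(x)}\Big)\,\nu(dx)=1$. Moreover, under condition (II), the measure $\mu$ as in (I) is unique.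
   Context: $\mathcal B(\mathbb R)$ is the Borel $\sigma$-algebra. A probability measure $\mu$ on $\mathcal B(\mathbb R)$ is zero-mean if $\int|x|\,\mu(dx)<\infty$ and $\int x\,\mu(dx)=0$. $\mu_+(A):=\mu(A\cap[0,\infty))$ for $A\in\mathcal B(\mathbb R)$. In the integral, $\frac x{\mathsf s(x)}:=0$ if $\mathsf s(x)=-\infty$, and $-\frac x{\mathsf s(x)}:=\infty$ if $\mathsf s(x)=0$, $x>0$. For a finite nonnegative measure $\nu$ on $\mathcal B(\mathbb R)$ (extended to $[-\infty,\infty]$ by $\nu(\{\pm\infty\})=0$) define $G_\nu\colon[-\infty,\infty]\to[0,\infty]$ by $G_\nu(x)=\int_{(0,x]}z\,\nu(dz)$ for $x\in[0,\infty]$ and $G_\nu(x)=\int_{[x,0)}(-z)\,\nu(dz)$ for $x\in[-\infty,0]$. For a non-atomic zero-mean probability measure $\mu$, let $x_{+}(h)=\inf\{x\in[0,\infty]\colon G_\mu(x)\ge h\}$ and $x_{-}(h)=\sup\{x\in[-\infty,0]\colon G_\mu(x)\ge h\}$ (with $\inf\emptyset=\infty$, $\sup\emptyset=-\infty$); the reciprocating function $\mathsf r_\mu\colon[-\infty,\infty]\to[-\infty,\infty]$ of $\mu$ is $\mathsf r_\mu(x)=x_-(G_\mu(x))$ for $x\in[0,\infty]$ and $\mathsf r_\mu(x)=x_+(G_\mu(x))$ for $x\in[-\infty,0]$. *)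

theory Defs
  imports "HOL-Probability.Probability"
begin

text \<open>Atoms are taken in the general measure-theoretic sense.\<close>

definition is_atom :: "'a measure \<Rightarrow> 'a set \<Rightarrow> bool" where
  "is_atom M A \<longleftrightarrow> A \<in> sets M \<and> emeasure M A > 0 \<and>
     (\<forall>B\<in>sets M. B \<subseteq> A \<longrightarrow> emeasure M B = 0 \<or> emeasure M B = emeasure M A)"

definition non_atomic :: "'a measure \<Rightarrow> bool" where
  "non_atomic M \<longleftrightarrow> (\<nexists>A. is_atom M A)"

definition zero_mean :: "real measure \<Rightarrow> bool" where
  "zero_mean \<mu> \<longleftrightarrow> integrable \<mu> (\<lambda>x. x) \<and> integral\<^sup>L \<mu> (\<lambda>x. x) = 0"

definition pos_part :: "real measure \<Rightarrow> real measure" where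
  "pos_part \<mu> = measure_of UNIV (sets borel) (\<lambda>A. emeasure \<mu> (A \<inter> {0..}))"

lemma sets_pos_part [simp]: "sets (pos_part \<mu>) = sets borel"
  unfolding pos_part_def by (metis sets.sets_measure_of_eq space_borel)

lemma emeasure_pos_part:
  assumes "sets \<mu> = sets borel" "A \<in> sets borel"
  shows "emeasure (pos_part \<mu>) A = emeasure \<mu> (A \<inter> {0..})"
proof (rule emeasure_measure_of[OF pos_part_def])
  show "countably_additive (sets (pos_part \<mu>)) (\<lambda>A. emeasure \<mu> (A \<inter> {0..}))"
  proof (rule countably_additiveI)
    fix F :: "nat \<Rightarrow> real set"
    assume F: "range F \<subseteq> sets (pos_part \<mu>)" "disjoint_family F"
    have "(\<Sum>i. emeasure \<mu> (F i \<inter> {0..})) = emeasure \<mu> (\<Union>i. F i \<inter> {0..})"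
      using F assms(1) by (intro suminf_emeasure) (auto simp: disjoint_family_on_def)
    then show "(\<Sum>i. emeasure \<mu> (F i \<inter> {0..})) = emeasure \<mu> (\<Union> (range F) \<inter> {0..})"
      by simp
  qed
qed (use assms in \<open>auto simp: positive_def\<close>)

definition G :: "real measure \<Rightarrow> ereal \<Rightarrow> ennreal" where
  "G \<nu> x = (if x \<ge> 0
     then (\<integral>\<^sup>+z\<in>{z. 0 < z \<and> ereal z \<le> x}. ennreal z \<partial>\<nu>)
     else (\<integral>\<^sup>+z\<in>{z. x \<le> ereal z \<and> z < 0}. ennreal (- z) \<partial>\<nu>))"

definition x_plus :: "real measure \<Rightarrow> ennreal \<Rightarrow> ereal" where
  "x_plus \<mu> h = Inf {x. 0 \<le> x \<and> G \<mu> x \<ge> h}"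

definition x_minus :: "real measure \<Rightarrow> ennreal \<Rightarrow> ereal" where
  "x_minus \<mu> h = Sup {x. x \<le> 0 \<and> G \<mu> x \<ge> h}"

definition recip :: "real measure \<Rightarrow> ereal \<Rightarrow> ereal" where
  "recip \<mu> x = (if x \<ge> 0 then x_minus \<mu> (G \<mu> x) else x_plus \<mu> (G \<mu> x))"

text \<open>
  The value of \<open>- x / t\<close> for \<open>x > 0\<close>.  The two special cases are spelled out because
  division on \<^typ>\<open>ereal\<close> has \<open>x / 0 = \<infinity>\<close>, hence \<open>- (x / 0) = - \<infinity>\<close>, for \<open>x > 0\<close>.
\<close>

definition neg_quot :: "real \<Rightarrow> ereal \<Rightarrow> ereal" where
  "neg_quot x t = (if t = 0 then \<infinity> else if t = - \<infinity> then 0 else - (ereal x / t))"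

text \<open>
  A function on \<open>[0, \<infinity>]\<close> is represented by a function on \<^typ>\<open>ereal\<close> whose values at
  negative arguments are irrelevant.  For \<open>x \<le> y\<close> in \<^typ>\<open>ereal\<close>, the preimage
  \<open>ereal -` {x<..<y}\<close> is the set of reals in the extended open interval, which carries all
  of the mass of \<open>\<nu>\<close> extended by \<open>\<nu>({\<plusminus>\<infinity>}) = 0\<close>.  In the last condition
  \<^const>\<open>e2ennreal\<close>, which sends negative values to \<open>0\<close>, cuts nothing off: the first two
  conditions give \<open>s \<le> 0\<close> on \<open>[0, \<infinity>]\<close>, so the integrand is at least \<open>1\<close>.
\<close>

definition recip_conditions :: "(ereal \<Rightarrow> ereal) \<Rightarrow> real measure \<Rightarrow> bool" where
  "recip_conditions s \<nu> \<longleftrightarrow>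
     s 0 = 0 \<and>
     antimono_on {0..} s \<and>
     (\<forall>x>0. (s \<longlongrightarrow> s x) (at_left x)) \<and>
     emeasure \<nu> {..<0} = 0 \<and>
     G \<nu> \<infinity> < \<infinity> \<and>
     (\<forall>x. 0 \<le> x \<and> x < \<infinity> \<and> G \<nu> x < G \<nu> \<infinity> \<longrightarrow> s x > - \<infinity>) \<and>
     (\<forall>x>0. G \<nu> x > 0 \<longrightarrow> s x < 0) \<and>
     (\<forall>x y. 0 \<le> x \<and> x < y \<longrightarrow> (emeasure \<nu> (ereal -` {x<..<y}) = 0 \<longleftrightarrow> s x = s y)) \<and>
     (\<integral>\<^sup>+x\<in>{0<..}. e2ennreal (1 + neg_quot x (s (ereal x))) \<partial>\<nu>) = 1"

definition recip_realizes :: "real measure \<Rightarrow> (ereal \<Rightarrow> ereal) \<Rightarrow> real measure \<Rightarrow> bool" where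
  "recip_realizes \<mu> s \<nu> \<longleftrightarrow>
     real_distribution \<mu> \<and> non_atomic \<mu> \<and> zero_mean \<mu> \<and>
     pos_part \<mu> = \<nu> \<and> (\<forall>x\<ge>0. recip \<mu> x = s x)"

end

theory Submission
  imports Defs
begin

text \<open>
  Move everything to \<open>[-\<infinity>, \<infinity>]\<close> and let \<open>P\<close>, \<open>N\<close> be the measures \<open>z \<mu>(dz)\<close> on \<open>z > 0\<close> and
  \<open>-z \<mu>(dz)\<close> on \<open>z < 0\<close>.  They have equal finite mass exactly when \<open>\<mu>\<close> has zero mean, and
  \<open>G\<^sub>\<mu>(x) = P[-\<infinity>, x]\<close> for \<open>x \<ge> 0\<close>, \<open>G\<^sub>\<mu>(y) = N[y, \<infinity>]\<close> for \<open>y \<le> 0\<close>.  The reciprocating function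
  \<open>r\<close> is the generalized inverse determined by \<open>y \<le> r x \<longleftrightarrow> P[-\<infinity>, x] \<le> N[y, \<infinity>]\<close>; hence it is the
  monotone transport map that pushes \<open>P\<close> forward to \<open>N\<close>.  Dividing \<open>N\<close> by \<open>-y\<close> recovers the
  negative part of \<open>\<mu>\<close> as the image under \<open>s\<close> of the measure \<open>-x / s(x) \<nu>(dx)\<close>.  This gives
  uniqueness, turns the last condition of (II) into the statement that \<open>\<mu>\<close> has mass 1, and tells how
  to build \<open>\<mu>\<close> from \<open>s\<close> and \<open>\<nu>\<close>.
\<close>

subsection \<open>Monotone transport on the extended reals\<close>

text \<open>On the extended line every supremum and infimum exists, so quantiles need no separate
  treatment at the ends. The points at plus and minus infinity are required to be null as
  well.\<close>

locale atomless_ereal_measure = finite_measure E for E :: "ereal measure" +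
  assumes sets_eq_borel [simp, measurable_cong]: "sets E = sets borel"
    and emeasure_singleton [simp]: "emeasure E {x} = 0"
begin

lemma space_eq_UNIV [simp]: "space E = UNIV"
  using sets_eq_imp_space_eq[OF sets_eq_borel] by simp

lemma emeasure_lessThan: "emeasure E {..<x} = emeasure E {..x}"
proof -
  have "emeasure E {..x} = emeasure E ({..<x} \<union> {x})"
    by (rule arg_cong[where f = "emeasure E"]) auto
  also have "\<dots> = emeasure E {..<x} + emeasure E {x}"
    by (intro plus_emeasure[symmetric]) auto
  finally show ?thesis by simp
qed

text \<open>Left-continuity of the distribution function: the open half-line below \<open>x\<close>
  is a countable increasing union of closed ones, and the point \<open>x\<close> itself is null. At
  minus infinity the premise is vacuous, but the half-line is a null singleton.\<close>

lemma emeasure_atMost_le: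
  assumes "\<And>u. u < x \<Longrightarrow> emeasure E {..u} \<le> h"
  shows "emeasure E {..x} \<le> h"
proof (cases "x = - \<infinity>")
  case True
  then have "{..x} = {x}" by auto
  then show ?thesis by simp
next
  case False
  then have ne: "{..<x} \<noteq> {}" by auto
  have Sup: "Sup {..<x} = x"
  proof (rule Sup_eqI)
    fix y assume "\<And>z. z \<in> {..<x} \<Longrightarrow> z \<le> y"
    then show "x \<le> y" by (auto intro: dense_ge_bounded dense_le)
  qed auto
  from Sup_countable_SUP[OF ne] obtain f :: "nat \<Rightarrow> ereal"
    where f: "incseq f" "range f \<subseteq> {..<x}" "x = (SUP i. f i)"
    unfolding Sup by auto
  have "{..<x} = (\<Union>i. {..f i})"
  proof safe
    fix y assume "y < x"
    then obtain i where "y < f i" unfolding f(3) less_SUP_iff by auto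
    then show "y \<in> (\<Union>i. {..f i})" by (auto intro: less_imp_le)
  qed (use f(2) in \<open>auto intro: le_less_trans\<close>)
  then have "emeasure E {..<x} = (SUP i. emeasure E {..f i})"
    using f(1) by (subst SUP_emeasure_incseq) (auto simp: incseq_def intro: order_trans)
  also have "\<dots> \<le> h"
    using f(2) by (intro SUP_least assms) auto
  finally show ?thesis by (simp add: emeasure_lessThan)
qed

text \<open>Right-continuity, by continuity from above of a finite measure. The bound by the total
  mass covers \<open>x = \<infinity>\<close>, where the first premise is vacuous.\<close>

lemma emeasure_atMost_ge:
  assumes "\<And>u. x < u \<Longrightarrow> h \<le> emeasure E {..u}" and "h \<le> emeasure E UNIV"
  shows "h \<le> emeasure E {..x}"
proof (cases "x = \<infinity>")
  case True
  then have "{..x} = UNIV" by auto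
  then show ?thesis using assms by simp
next
  case False
  then have ne: "{x<..} \<noteq> {}" by auto
  have Inf: "Inf {x<..} = x"
  proof (rule Inf_eqI)
    fix y assume "\<And>z. z \<in> {x<..} \<Longrightarrow> y \<le> z"
    then show "y \<le> x" by (auto intro: dense_ge)
  qed auto
  from Inf_countable_INF[OF ne] obtain f :: "nat \<Rightarrow> ereal"
    where f: "decseq f" "range f \<subseteq> {x<..}" "x = (INF i. f i)"
    unfolding Inf by auto
  have "{..x} = (\<Inter>i. {..f i})"
    using f(3) by (auto simp: le_INF_iff)
  then have "emeasure E {..x} = (INF i. emeasure E {..f i})"
    using f(1) by (subst INF_emeasure_decseq) (auto simp: decseq_def intro: order_trans)
  then show ?thesis
    using f(2) by (auto intro!: INF_greatest assms)
qed

text \<open>Carries both one-sided limits over from lower to upper half-lines.\<close>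

lemma reflect: "atomless_ereal_measure (distr E borel uminus)"
proof -
  interpret D: finite_measure "distr E borel uminus"
    by (rule finite_measure_distr) simp
  show ?thesis
  proof
    fix x :: ereal
    have "uminus -` {x} = {- x}" by (auto simp: ereal_uminus_eq_reorder)
    then show "emeasure (distr E borel uminus) {x} = 0"
      by (simp add: emeasure_distr)
  qed simp
qed

lemma emeasure_reflect: "emeasure (distr E borel uminus) {..x} = emeasure E {-x..}"
proof -
  have "uminus -` {..x} = {-x..}" by (auto simp: ereal_uminus_le_reorder)
  then show ?thesis by (simp add: emeasure_distr)
qed

lemma emeasure_atLeast_le:
  assumes "\<And>u. x < u \<Longrightarrow> emeasure E {u..} \<le> h"
  shows "emeasure E {x..} \<le> h"
proof -
  interpret R: atomless_ereal_measure "distr E borel uminus" by (rule reflect)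
  have "emeasure (distr E borel uminus) {..-x} \<le> h"
  proof (rule R.emeasure_atMost_le)
    fix u assume "u < - x"
    then have "x < - u" by (simp add: ereal_less_uminus_reorder)
    then show "emeasure (distr E borel uminus) {..u} \<le> h"
      unfolding emeasure_reflect by (rule assms)
  qed
  then show ?thesis by (simp add: emeasure_reflect)
qed

lemma emeasure_atLeast_ge:
  assumes "\<And>u. u < x \<Longrightarrow> h \<le> emeasure E {u..}" and "h \<le> emeasure E UNIV"
  shows "h \<le> emeasure E {x..}"
proof -
  interpret R: atomless_ereal_measure "distr E borel uminus" by (rule reflect)
  have "h \<le> emeasure (distr E borel uminus) {..-x}"
  proof (rule R.emeasure_atMost_ge)
    fix u assume "- x < u"
    then have "- u < x" by (simp add: ereal_uminus_less_reorder)
    then show "h \<le> emeasure (distr E borel uminus) {..u}"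
      unfolding emeasure_reflect by (rule assms(1))
  next
    show "h \<le> emeasure (distr E borel uminus) UNIV"
      using assms(2) by (simp add: emeasure_distr)
  qed
  then show ?thesis by (simp add: emeasure_reflect)
qed

text \<open>Left-continuity makes the sublevel set contain its supremum \<open>q\<close>;
  right-continuity excludes a jump there, so the level \<open>h\<close> is attained exactly. Thus
  \<open>q\<close> is the largest quantile of level \<open>h\<close>.\<close>

lemma quantile_exists:
  assumes "h \<le> emeasure E UNIV"
  obtains q where "{x. emeasure E {..x} \<le> h} = {..q}" "emeasure E {..q} = h"
proof
  define S where "S = {x. emeasure E {..x} \<le> h}"
  define q where "q = Sup S"
  have down: "x \<in> S" if "x \<le> y" "y \<in> S" for x y
    using that emeasure_mono[of "{..x}" "{..y}" E] by (auto simp: S_def)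
  have "emeasure E {..q} \<le> h"
  proof (rule emeasure_atMost_le)
    fix u assume "u < q"
    then obtain v where "v \<in> S" "u < v" by (auto simp: q_def less_Sup_iff)
    then show "emeasure E {..u} \<le> h" using down[of u v] by (auto simp: S_def)
  qed
  then have q: "q \<in> S" by (simp add: S_def)
  then show eq: "{x. emeasure E {..x} \<le> h} = {..q}"
    using down by (auto simp: q_def S_def[symmetric] intro: Sup_upper)
  have "h \<le> emeasure E {..q}"
  proof (rule emeasure_atMost_ge)
    fix u assume "q < u"
    then have "u \<notin> {x. emeasure E {..x} \<le> h}" by (simp add: eq)
    then show "h \<le> emeasure E {..u}" by simp
  qed (rule assms)
  with q show "emeasure E {..q} = h" by (auto simp: S_def)
qed

lemma emeasure_quantile_level:
  "h \<le> emeasure E UNIV \<Longrightarrow> emeasure E {x. emeasure E {..x} \<le> h} = h"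
  by (metis quantile_exists)

end

section \<open>Half-lines as generators, and measurability of antitone maps\<close>

lemma ereal_measure_eqI:
  fixes M N :: "ereal measure"
  assumes sets: "sets M = sets borel" "sets N = sets borel" and fin: "emeasure M UNIV \<noteq> \<infinity>"
    and eq: "\<And>x. emeasure M {x..} = emeasure N {x..}"
  shows "M = N"
proof (rule measure_eqI_generator_eq
    [where E = "range atLeast" and \<Omega> = UNIV and A = "\<lambda>_::nat. {- \<infinity>..}"])
  have borel: "(borel :: ereal measure) = sigma UNIV (range atLeast)"
  proof (safe intro!: borel_eq_sigmaI1[OF borel_Iio])
    fix x :: ereal
    have "{..<x} = space (sigma UNIV (range atLeast)) - {x..}" by auto
    then show "{..<x} \<in> sets (sigma UNIV (range atLeast))"
      by (simp only:) (intro sets.compl_sets, auto)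
  qed auto
  show "Int_stable (range (atLeast :: ereal \<Rightarrow> _))"
  proof (clarsimp simp: Int_stable_def)
    fix a b :: ereal
    have "{a..} \<inter> {b..} = {max a b..}" by auto
    then show "{a..} \<inter> {b..} \<in> range atLeast" by simp
  qed
  show "sets M = sigma_sets UNIV (range atLeast)" "sets N = sigma_sets UNIV (range atLeast)"
    unfolding sets borel by auto
  show "range (\<lambda>n::nat. {- \<infinity> :: ereal..}) \<subseteq> range atLeast" by auto
  show "(\<Union>n::nat. {- \<infinity> :: ereal..}) = UNIV" by auto
  have "{- \<infinity> :: ereal..} = UNIV" by auto
  then show "\<And>n::nat. emeasure M {- \<infinity>..} \<noteq> \<infinity>" using fin by simp
qed (use eq in auto)

text \<open>Superlevel sets of an antitone map are downward closed, hence open or closed lower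
  half-lines.\<close>

lemma borel_measurable_antimono_ereal:
  fixes f :: "ereal \<Rightarrow> ereal"
  assumes "antimono f"
  shows "f \<in> borel_measurable borel"
proof (rule borel_measurableI_ge)
  fix y
  define D where "D = {x. y \<le> f x}"
  have down: "x \<in> D" if "x \<le> z" "z \<in> D" for x z
    using that antimonoD[OF assms, of x z] by (auto simp: D_def)
  have "D = {..Sup D} \<or> D = {..<Sup D}"
  proof (cases "Sup D \<in> D")
    case True
    then have "D = {..Sup D}" using down by (auto intro: Sup_upper)
    then show ?thesis ..
  next
    case False
    have "x < Sup D" if "x \<in> D" for x
      using that False Sup_upper[OF that] by (auto simp: order_less_le)
    moreover have "x \<in> D" if "x < Sup D" for x
      using that down by (auto simp: less_Sup_iff intro: less_imp_le)
    ultimately have "D = {..<Sup D}" by auto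
    then show ?thesis ..
  qed
  then have "D \<in> sets borel" by (metis atMost_borel lessThan_borel)
  then show "{x \<in> space borel. y \<le> f x} \<in> sets borel" by (simp add: D_def)
qed

section \<open>The generalized inverse and its pushforward\<close>

locale balanced_measures =
  P: atomless_ereal_measure P + N: atomless_ereal_measure N for P N :: "ereal measure" +
  assumes N_nonneg: "emeasure N {0..} = 0"
    and mass_eq: "emeasure P UNIV = emeasure N UNIV"
begin

text \<open>The cap \<open>y \<le> 0\<close> makes \<open>r x\<close> equal to 0, not infinity, when
  \<open>{..x}\<close> is a null set of \<open>P\<close>.\<close>

definition r :: "ereal \<Rightarrow> ereal" where
  "r x = Sup {y. y \<le> 0 \<and> emeasure P {..x} \<le> emeasure N {y..}}"

lemma P_le_N_UNIV: "emeasure P A \<le> emeasure N UNIV"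
  using emeasure_space[of P A] by (simp add: mass_eq)

lemma r_nonpos: "r x \<le> 0"
  unfolding r_def by (auto intro: Sup_least)

text \<open>A Galois connection. The supremum defining \<open>r\<close> is attained because the mass
  of \<open>{y..}\<close> under \<open>N\<close> varies continuously with \<open>y\<close>.\<close>

lemma le_r_iff:
  assumes "y \<le> 0"
  shows "y \<le> r x \<longleftrightarrow> emeasure P {..x} \<le> emeasure N {y..}"
proof
  assume "emeasure P {..x} \<le> emeasure N {y..}"
  then show "y \<le> r x" using assms by (auto simp: r_def intro: Sup_upper)
next
  assume "y \<le> r x"
  have "emeasure P {..x} \<le> emeasure N {r x..}"
  proof (rule N.emeasure_atLeast_ge)
    fix u assume "u < r x"
    then obtain v where "emeasure P {..x} \<le> emeasure N {v..}" "u < v"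
      by (auto simp: r_def less_Sup_iff)
    moreover have "emeasure N {v..} \<le> emeasure N {u..}"
      using \<open>u < v\<close> by (intro emeasure_mono) auto
    ultimately show "emeasure P {..x} \<le> emeasure N {u..}" by simp
  qed (rule P_le_N_UNIV)
  also have "\<dots> \<le> emeasure N {y..}"
    using \<open>y \<le> r x\<close> by (intro emeasure_mono) auto
  finally show "emeasure P {..x} \<le> emeasure N {y..}" .
qed

text \<open>Above \<open>r x\<close> the Galois connection reverses the inequality; letting
  \<open>u\<close> decrease to \<open>r x\<close> keeps it, since \<open>N\<close> has no
  atoms.\<close>

lemma emeasure_N_atLeast_r: "emeasure N {r x..} = emeasure P {..x}"
proof (rule antisym)
  show "emeasure P {..x} \<le> emeasure N {r x..}"
    using le_r_iff[OF r_nonpos] by blast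
  show "emeasure N {r x..} \<le> emeasure P {..x}"
  proof (rule N.emeasure_atLeast_le)
    fix u assume u: "r x < u"
    show "emeasure N {u..} \<le> emeasure P {..x}"
    proof (cases "u \<le> 0")
      case True
      then show ?thesis using le_r_iff[OF True, of x] u by auto
    next
      case False
      then have "emeasure N {u..} \<le> emeasure N {0..}" by (intro emeasure_mono) auto
      then show ?thesis by (simp add: N_nonneg)
    qed
  qed
qed

lemma antimono_r: "antimono r"
proof (rule antimonoI)
  fix x y :: ereal assume "x \<le> y"
  then have "emeasure P {..x} \<le> emeasure P {..y}" by (intro emeasure_mono) auto
  moreover have "emeasure P {..y} \<le> emeasure N {r y..}" by (simp add: emeasure_N_atLeast_r)
  ultimately show "r y \<le> r x" by (simp add: le_r_iff r_nonpos)
qed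

lemma r_eq_iff: "r x = r y \<longleftrightarrow> emeasure P {..x} = emeasure P {..y}"
proof
  assume "r x = r y"
  then show "emeasure P {..x} = emeasure P {..y}"
    by (simp flip: emeasure_N_atLeast_r)
qed (simp add: r_def)

text \<open>Antitonicity bounds \<open>r\<close> from below on the left of \<open>x\<close>. A
  persistent bound \<open>a \<le> r y\<close> there would pass through \<open>le_r_iff\<close> and
  left-continuity of the distribution function of \<open>P\<close> to \<open>x\<close>
  itself.\<close>

lemma r_left_continuous: "(r \<longlongrightarrow> r x) (at_left x)"
proof (rule order_tendstoI)
  fix a assume a: "a < r x"
  have "a < r y" if "y < x" for y
    using a antimonoD[OF antimono_r, of y x] that by (auto intro: less_le_trans)
  then show "eventually (\<lambda>y. a < r y) (at_left x)"
    by (auto simp: eventually_at_filter)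
next
  fix a assume a: "r x < a"
  have "\<exists>y<x. r y < a" if "x \<noteq> - \<infinity>"
  proof (rule ccontr)
    assume "\<not> ?thesis"
    then have ge: "a \<le> r y" if "y < x" for y using that by auto
    \<comment> \<open>Evaluating the bound at minus infinity puts \<open>a\<close> below 0, the
      range in which \<open>le_r_iff\<close> applies.\<close>
    have "- \<infinity> < x" using that by auto
    from ge[OF this] have "a \<le> 0" using r_nonpos order_trans by blast
    then have "emeasure P {..x} \<le> emeasure N {a..}"
      using ge by (auto simp: le_r_iff intro: P.emeasure_atMost_le[where x = x])
    then have "a \<le> r x" by (simp only: le_r_iff[OF \<open>a \<le> 0\<close>])
    with a show False by simp
  qed
  then obtain y where "x \<noteq> - \<infinity> \<Longrightarrow> y < x \<and> r y < a" by blast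
  then have "eventually (\<lambda>z. z \<in> {y<..<x}) (at_left x) \<and> r y < a" if "x \<noteq> - \<infinity>"
    using that by (auto intro: eventually_at_leftI[of y])
  then have "eventually (\<lambda>z. r z < a) (at_left x)" if "x \<noteq> - \<infinity>"
    using that antimonoD[OF antimono_r, of y]
    by (auto elim!: eventually_mono) (meson less_imp_le order_le_less_trans)
  \<comment> \<open>Nothing lies to the left of minus infinity, so this filter is trivial.\<close>
  moreover have "eventually (\<lambda>z. r z < a) (at_left (- \<infinity>))"
    by (auto simp: eventually_at_filter)
  ultimately show "eventually (\<lambda>z. r z < a) (at_left x)" by metis
qed

lemma r_measurable [measurable]: "r \<in> borel_measurable borel"
  by (rule borel_measurable_antimono_ereal[OF antimono_r])

text \<open>By \<open>le_r_iff\<close>, the preimage of \<open>{y..}\<close> is a sublevel set of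
  the distribution function of \<open>P\<close>, and its mass equals its level because
  \<open>P\<close> has no atoms.\<close>

lemma distr_r: "distr P borel r = N"
proof (rule ereal_measure_eqI)
  have [measurable]: "r \<in> borel_measurable P"
    by (subst measurable_cong_sets[OF P.sets_eq_borel refl]) simp
  show "emeasure (distr P borel r) UNIV \<noteq> \<infinity>"
    using P.emeasure_finite by (simp add: emeasure_distr)
  fix y :: ereal
  show "emeasure (distr P borel r) {y..} = emeasure N {y..}"
  proof (cases "y \<le> 0")
    case True
    have "r -` {y..} = {x. emeasure P {..x} \<le> emeasure N {y..}}"
      using True by (auto simp: le_r_iff)
    moreover have "emeasure N {y..} \<le> emeasure P UNIV"
      using emeasure_space[of N "{y..}"] by (simp add: mass_eq)
    ultimately show ?thesis
      by (simp add: emeasure_distr P.emeasure_quantile_level)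
  next
    case False
    have "r -` {y..} = {}" using False r_nonpos order_trans by auto
    moreover have "emeasure N {y..} \<le> emeasure N {0..}"
      using False by (intro emeasure_mono) auto
    ultimately show ?thesis by (simp add: emeasure_distr N_nonneg)
  qed
qed auto

end

subsection \<open>Tilted measures on the real line\<close>

lemma non_atomic_emeasure_singleton:
  fixes M :: "real measure"
  assumes "sets M = sets borel" "non_atomic M"
  shows "emeasure M {x} = 0"
proof (rule ccontr)
  assume "emeasure M {x} \<noteq> 0"
  then have "is_atom M {x}"
    using assms(1) by (auto simp: is_atom_def subset_singleton_iff zero_less_iff_neq_zero)
  with assms(2) show False by (auto simp: non_atomic_def)
qed

lemma atomless_distr_ereal:
  fixes K :: "real measure"
  assumes "finite_measure K" "sets K = sets borel" "\<And>x. emeasure K {x} = 0"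
  shows "atomless_ereal_measure (distr K borel ereal)"
proof -
  note [measurable_cong] = assms(2)
  interpret K: finite_measure K by fact
  interpret D: finite_measure "distr K borel ereal"
    by (rule K.finite_measure_distr) simp
  show ?thesis
  proof
    fix x :: ereal
    have "ereal -` {x} \<subseteq> {real_of_ereal x}" by auto
    then have "emeasure K (ereal -` {x}) \<le> emeasure K {real_of_ereal x}"
      using assms(2) by (intro emeasure_mono) auto
    then show "emeasure (distr K borel ereal) {x} = 0"
      using sets_eq_imp_space_eq[OF assms(2)] by (simp add: emeasure_distr assms(3))
  qed simp
qed

text \<open>For a finite Borel measure on the line, null singletons already exclude general atoms: a
  quantile of the restriction \<open>K\<close> to \<open>A\<close> cuts off exactly half of the mass
  of \<open>A\<close>.\<close>

lemma non_atomicI: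
  fixes M :: "real measure"
  assumes "finite_measure M" and sets: "sets M = sets borel" and null: "\<And>x. emeasure M {x} = 0"
  shows "non_atomic M"
  unfolding non_atomic_def
proof
  assume "\<exists>A. is_atom M A"
  then obtain A where A: "A \<in> sets borel" "emeasure M A > 0"
    and atom: "\<And>B. B \<in> sets borel \<Longrightarrow> B \<subseteq> A \<Longrightarrow> emeasure M B = 0 \<or> emeasure M B = emeasure M A"
    by (auto simp: is_atom_def sets)
  note [measurable_cong] = sets and [measurable] = A(1)
  have space: "space M = UNIV" using sets_eq_imp_space_eq[OF sets] by simp
  interpret finite_measure M by fact
  define K where "K = density M (indicator A)"
  have K: "emeasure K B = emeasure M (A \<inter> B)" if "B \<in> sets borel" for B
    unfolding K_def using that
    by (subst emeasure_density) (auto simp: indicator_inter_arith[symmetric] sets)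
  have [simp, measurable_cong]: "sets K = sets borel" and [simp]: "space K = UNIV" by (simp_all add: K_def sets space)
  have "finite_measure K"
    by standard (use K[of UNIV] in simp)
  moreover have "emeasure K {x} = 0" for x
  proof -
    have "emeasure M (A \<inter> {x}) \<le> emeasure M {x}" by (intro emeasure_mono) (auto simp: sets)
    then show ?thesis by (simp add: K null)
  qed
  ultimately interpret E: atomless_ereal_measure "distr K borel ereal"
    by (intro atomless_distr_ereal) auto
  define h where "h = emeasure M A / 2"
  have h: "0 < h" "h < emeasure M A"
    using A(2) emeasure_finite[of A] by (cases "emeasure M A"; simp add: h_def ennreal_less_iff ennreal_zero_less_divide divide_ennreal flip: ennreal_numeral)+
  have "h \<le> emeasure (distr K borel ereal) UNIV"
    using h by (simp add: emeasure_distr K less_imp_le)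
  from E.quantile_exists[OF this] obtain q
    where "emeasure (distr K borel ereal) {..q} = h" by blast
  moreover have vimage [measurable]: "ereal -` {..q} \<in> sets borel"
    by (rule measurable_sets_borel[of _ borel]) auto
  ultimately have "emeasure M (A \<inter> ereal -` {..q}) = h"
    by (simp add: emeasure_distr K)
  with atom[of "A \<inter> ereal -` {..q}"] h show False by (auto simp: sets)
qed

text \<open>\<^const>\<open>ennreal\<close> sends negative values to \<open>0\<close>, so \<open>w = (\<lambda>z. z)\<close> gives a measure on \<open>(0, \<infinity>)\<close>
  and \<open>w = uminus\<close> a measure on \<open>(-\<infinity>, 0)\<close>.\<close>

definition tilt :: "(real \<Rightarrow> real) \<Rightarrow> real measure \<Rightarrow> ereal measure" where
  "tilt w \<nu> = distr (density \<nu> (\<lambda>z. ennreal (w z))) borel ereal"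

lemma sets_tilt [simp, measurable_cong]: "sets (tilt w \<nu>) = sets borel"
  and space_tilt [simp]: "space (tilt w \<nu>) = UNIV"
  by (simp_all add: tilt_def)

context
  fixes \<nu> :: "real measure" and w :: "real \<Rightarrow> real"
  assumes sets_\<nu> [measurable_cong]: "sets \<nu> = sets borel"
    and w_meas [measurable]: "w \<in> borel_measurable borel"
begin

lemma nn_integral_tilt:
  assumes [measurable]: "f \<in> borel_measurable borel"
  shows "(\<integral>\<^sup>+y. f y \<partial>tilt w \<nu>) = (\<integral>\<^sup>+z. ennreal (w z) * f (ereal z) \<partial>\<nu>)"
  unfolding tilt_def by (subst nn_integral_distr, measurable, subst nn_integral_density) auto

lemma emeasure_tilt:
  assumes [measurable]: "A \<in> sets borel"
  shows "emeasure (tilt w \<nu>) A = (\<integral>\<^sup>+z. ennreal (w z) * indicator A (ereal z) \<partial>\<nu>)"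
  by (subst nn_integral_tilt[symmetric]) (auto simp: nn_integral_indicator)

lemma emeasure_tilt_UNIV: "emeasure (tilt w \<nu>) UNIV = (\<integral>\<^sup>+z. ennreal (w z) \<partial>\<nu>)"
  by (simp add: emeasure_tilt)

lemma atomless_tilt:
  assumes "\<And>x. emeasure \<nu> {x} = 0" "emeasure (tilt w \<nu>) UNIV < \<infinity>"
  shows "atomless_ereal_measure (tilt w \<nu>)"
  unfolding tilt_def
proof (rule atomless_distr_ereal)
  have space: "space \<nu> = UNIV" using sets_eq_imp_space_eq[OF sets_\<nu>] by simp
  show "sets (density \<nu> (\<lambda>z. ennreal (w z))) = sets borel" by (simp add: sets_\<nu>)
  show "finite_measure (density \<nu> (\<lambda>z. ennreal (w z)))"
    using assms(2) by (intro finite_measureI) (simp add: tilt_def emeasure_distr space)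
  fix x
  have "{x} \<in> null_sets \<nu>" using assms(1) by (auto simp: sets_\<nu>)
  then show "emeasure (density \<nu> (\<lambda>z. ennreal (w z))) {x} = 0"
    by (subst emeasure_density) (auto simp: sets_\<nu> nn_integral_null_set)
qed

end

lemma G_nonneg:
  assumes "sets \<nu> = sets borel" "0 \<le> x"
  shows "G \<nu> x = emeasure (tilt (\<lambda>z. z) \<nu>) {..x}"
proof -
  have "ennreal z * indicator {z. 0 < z \<and> ereal z \<le> x} z = ennreal z * indicator {..x} (ereal z)"
    for z by (auto simp: indicator_def ennreal_neg not_less)
  then show ?thesis using assms by (simp add: G_def emeasure_tilt)
qed

lemma G_nonpos:
  assumes "sets \<nu> = sets borel" "x \<le> 0"
  shows "G \<nu> x = emeasure (tilt uminus \<nu>) {x..}"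
proof (cases "x = 0")
  \<comment> \<open>At 0 the function \<open>G\<close> takes its first branch, so both sides are
    computed separately and vanish.\<close>
  case True
  have "(\<integral>\<^sup>+z. ennreal (- z) * indicator {0..} (ereal z) \<partial>\<nu>) = (\<integral>\<^sup>+z. 0 \<partial>\<nu>)"
    by (intro nn_integral_cong) (auto simp: indicator_def ennreal_neg)
  then have "emeasure (tilt uminus \<nu>) {0..} = 0"
    using assms by (simp add: emeasure_tilt)
  moreover have "ennreal z * indicator {z. 0 < z \<and> ereal z \<le> 0} z = 0" for z
    by (auto simp: indicator_def)
  ultimately show ?thesis by (simp add: G_def True)
next
  case False
  then have "\<not> 0 \<le> x" using assms(2) by auto
  moreover have "ennreal (- z) * indicator {z. x \<le> ereal z \<and> z < 0} z
      = ennreal (- z) * indicator {x..} (ereal z)" for z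
    by (auto simp: indicator_def ennreal_neg not_less)
  ultimately show ?thesis using assms by (simp add: G_def emeasure_tilt)
qed

text \<open>The two tilted masses are the integrals of the positive and negative parts of the
  identity; once they agree, finiteness of one gives integrability.\<close>

lemma zero_mean_iff:
  assumes "sets \<mu> = sets borel"
  shows "zero_mean \<mu> \<longleftrightarrow> emeasure (tilt (\<lambda>z. z) \<mu>) UNIV < \<infinity> \<and>
    emeasure (tilt uminus \<mu>) UNIV = emeasure (tilt (\<lambda>z. z) \<mu>) UNIV"
    (is "_ \<longleftrightarrow> ?p < \<infinity> \<and> ?n = ?p")
proof -
  have meas: "(\<lambda>x. x) \<in> borel_measurable \<mu>"
    by (subst measurable_cong_sets[OF assms refl]) simp
  have pn: "?p = (\<integral>\<^sup>+z. ennreal z \<partial>\<mu>)" "?n = (\<integral>\<^sup>+z. ennreal (- z) \<partial>\<mu>)"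
    using assms by (simp_all add: emeasure_tilt_UNIV)
  have int: "integrable \<mu> (\<lambda>x. x) \<longleftrightarrow> ?p \<noteq> \<infinity> \<and> ?n \<noteq> \<infinity>"
    using meas by (simp add: real_integrable_def pn)
  have "integral\<^sup>L \<mu> (\<lambda>x. x) = enn2real ?p - enn2real ?n" if "integrable \<mu> (\<lambda>x. x)"
    using real_lebesgue_integral_def[OF that] by (simp add: pn)
  then show ?thesis
    unfolding zero_mean_def int
    by (cases "?p" rule: ennreal_cases; cases "?n" rule: ennreal_cases)
       (use int in auto)
qed

lemma pos_part_eq_density:
  assumes "sets \<mu> = sets borel"
  shows "pos_part \<mu> = density \<mu> (indicator {0..})"
proof (rule measure_eqI)
  fix A assume "A \<in> sets (pos_part \<mu>)"
  then show "emeasure (pos_part \<mu>) A = emeasure (density \<mu> (indicator {0..})) A"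
    using assms
    by (simp add: emeasure_pos_part emeasure_density indicator_inter_arith[symmetric] Int_commute
        nn_integral_indicator)
qed (simp add: assms)

lemma tilt_pos_part:
  assumes "sets \<mu> = sets borel"
  shows "tilt (\<lambda>z. z) (pos_part \<mu>) = tilt (\<lambda>z. z) \<mu>"
proof (rule measure_eqI)
  note [measurable_cong] = assms
  fix A assume "A \<in> sets (tilt (\<lambda>z. z) (pos_part \<mu>))"
  then have [measurable]: "A \<in> sets borel" by simp
  have eq: "indicator {0..} z * (ennreal z * indicator A (ereal z)) = ennreal z * indicator A (ereal z)"
    for z :: real by (auto simp: indicator_def ennreal_neg)
  show "emeasure (tilt (\<lambda>z. z) (pos_part \<mu>)) A = emeasure (tilt (\<lambda>z. z) \<mu>) A"
    using assms unfolding pos_part_eq_density[OF assms]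
    by (simp add: emeasure_tilt) (simp add: nn_integral_density eq)
qed simp

text \<open>The weight \<open>z\<close> is strictly positive on the gap because
  \<open>0 \<le> x\<close>, so \<open>\<nu>\<close> and its tilt have the same null sets there.
  Finiteness allows the mass of \<open>{..x}\<close> to be cancelled.\<close>

lemma emeasure_gap_eq_0_iff:
  assumes sets [measurable_cong]: "sets \<nu> = sets borel" and null: "\<And>x. emeasure \<nu> {x} = 0"
    and fin: "emeasure (tilt (\<lambda>z. z) \<nu>) UNIV < \<infinity>" and xy: "0 \<le> x" "x < y"
  shows "emeasure \<nu> (ereal -` {x<..<y}) = 0 \<longleftrightarrow>
    emeasure (tilt (\<lambda>z. z) \<nu>) {..x} = emeasure (tilt (\<lambda>z. z) \<nu>) {..y}"
proof -
  let ?T = "tilt (\<lambda>z. z) \<nu>" and ?S = "ereal -` {x<..<y}"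
  interpret T: atomless_ereal_measure ?T by (rule atomless_tilt) (use assms in auto)
  have S [measurable]: "?S \<in> sets borel" by (rule measurable_sets_borel[of _ borel]) auto
  have "emeasure ?T {..y} = emeasure ?T ({..x} \<union> {x<..<y})"
    unfolding T.emeasure_lessThan[symmetric]
    using xy by (intro arg_cong[where f = "emeasure ?T"]) auto
  also have "\<dots> = emeasure ?T {..x} + emeasure ?T {x<..<y}"
    by (intro plus_emeasure[symmetric]) auto
  finally have "emeasure ?T {..x} = emeasure ?T {..y} \<longleftrightarrow> emeasure ?T {x<..<y} = 0"
    using T.emeasure_finite[of "{..x}"]
    by (metis add.right_neutral ennreal_add_left_cancel infinity_ennreal_def)
  also have "\<dots> \<longleftrightarrow> (AE z in \<nu>. ennreal z * indicator {x<..<y} (ereal z) = 0)"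
    using sets by (simp add: emeasure_tilt nn_integral_0_iff_AE)
  also have "\<dots> \<longleftrightarrow> (AE z in \<nu>. z \<notin> ?S)"
  proof (rule AE_cong)
    fix z show "ennreal z * indicator {x<..<y} (ereal z) = 0 \<longleftrightarrow> z \<notin> ?S"
    proof (cases "z \<in> ?S")
      case True
      then have "0 < ereal z" using order_le_less_trans[OF xy(1), of "ereal z"] by auto
      then show ?thesis using True by simp
    qed (auto simp: indicator_def)
  qed
  also have "\<dots> \<longleftrightarrow> emeasure \<nu> ?S = 0"
    using sets sets_eq_imp_space_eq[OF sets] by (intro AE_iff_measurable) auto
  finally show ?thesis ..
qed

text \<open>Used for level sets of \<open>s\<close>, which may be uncountable: countably many null
  intervals and at most two extremal points cover \<open>C\<close>.\<close>

lemma AE_not_in_gaps: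
  fixes \<nu> :: "real measure"
  assumes sets: "sets \<nu> = sets borel" and null: "\<And>x. emeasure \<nu> {x} = 0"
    and gap: "\<And>x y. x \<in> C \<Longrightarrow> y \<in> C \<Longrightarrow> x < y \<Longrightarrow> emeasure \<nu> {x<..<y} = 0"
  shows "AE x in \<nu>. x \<notin> C"
proof -
  have single: "AE x in \<nu>. x \<noteq> a" for a
    by (rule AE_I'[of "{a}"]) (auto simp: null_sets_def null sets)
  \<comment> \<open>A point of \<open>C\<close> that is not extremal in \<open>C\<close> lies in a null interval with rational endpoints.\<close>
  have "AE x in \<nu>. \<forall>p\<in>\<rat>. \<forall>q\<in>\<rat>. emeasure \<nu> {p<..<q} = 0 \<longrightarrow> x \<notin> {p<..<q}"
  proof (intro AE_ball_countable' countable_rat)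
    fix p q :: real
    show "AE x in \<nu>. emeasure \<nu> {p<..<q} = 0 \<longrightarrow> x \<notin> {p<..<q}"
      by (cases "emeasure \<nu> {p<..<q} = 0")
         (auto intro!: AE_I'[of "{p<..<q}"] simp: null_sets_def sets)
  qed
  then show ?thesis
    \<comment> \<open>These choices are the minimum and maximum of \<open>C\<close> when they exist;
      otherwise they are arbitrary reals, whose exclusion is harmless.\<close>
    using single[of "SOME a. a \<in> C \<and> (\<forall>y\<in>C. a \<le> y)"] single[of "SOME b. b \<in> C \<and> (\<forall>y\<in>C. y \<le> b)"]
  proof eventually_elim
    case (elim x)
    show ?case
    proof
      assume x: "x \<in> C"
      have "\<not> (\<forall>y\<in>C. x \<le> y)"
      proof
        assume "\<forall>y\<in>C. x \<le> y"
        with x have "(SOME a. a \<in> C \<and> (\<forall>y\<in>C. a \<le> y)) = x"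
          by (intro some_equality) (auto intro: antisym)
        with elim show False by simp
      qed
      moreover have "\<not> (\<forall>y\<in>C. y \<le> x)"
      proof
        assume "\<forall>y\<in>C. y \<le> x"
        with x have "(SOME b. b \<in> C \<and> (\<forall>y\<in>C. y \<le> b)) = x"
          by (intro some_equality) (auto intro: antisym)
        with elim show False by simp
      qed
      ultimately obtain a b where ab: "a \<in> C" "b \<in> C" "a < x" "x < b"
        by (auto simp: not_le)
      then obtain p q where pq: "p \<in> \<rat>" "q \<in> \<rat>" "a < p" "p < x" "x < q" "q < b"
        using Rats_dense_in_real by metis
      then have "emeasure \<nu> {p<..<q} \<le> emeasure \<nu> {a<..<b}"
        by (intro emeasure_mono) (auto simp: sets)
      also have "\<dots> = 0" using ab by (intro gap) auto
      finally show False using elim(1) pq by auto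
    qed
  qed
qed

subsection \<open>Reconstruction from the positive part\<close>

definition add_measure :: "real measure \<Rightarrow> real measure \<Rightarrow> real measure" where
  "add_measure M N = measure_of UNIV (sets borel) (\<lambda>A. emeasure M A + emeasure N A)"

lemma sets_add_measure [simp, measurable_cong]: "sets (add_measure M N) = sets borel"
  and space_add_measure [simp]: "space (add_measure M N) = UNIV"
  using sets.sets_measure_of_eq[of "borel :: real measure"]
  by (simp_all add: add_measure_def space_measure_of_conv)

context
  fixes M N :: "real measure"
  assumes sets_M [measurable_cong]: "sets M = sets borel" and sets_N [measurable_cong]: "sets N = sets borel"
begin

lemma emeasure_add_measure:
  assumes "A \<in> sets borel"
  shows "emeasure (add_measure M N) A = emeasure M A + emeasure N A"
proof (rule emeasure_measure_of[OF add_measure_def])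
  show "countably_additive (sets (add_measure M N)) (\<lambda>A. emeasure M A + emeasure N A)"
    by (rule countably_additiveI)
       (simp add: suminf_add[symmetric] suminf_emeasure sets_M sets_N)
qed (use assms in \<open>auto simp: positive_def\<close>)

lemma nn_integral_add_measure:
  assumes "f \<in> borel_measurable borel"
  shows "(\<integral>\<^sup>+x. f x \<partial>add_measure M N) = (\<integral>\<^sup>+x. f x \<partial>M) + (\<integral>\<^sup>+x. f x \<partial>N)"
  using assms
proof (induct rule: borel_measurable_induct)
  case (set A)
  then show ?case
    by (simp add: nn_integral_indicator emeasure_add_measure sets_M sets_N)
next
  case (seq U)
  then have [measurable]: "U i \<in> borel_measurable borel" for i by auto
  have "(\<integral>\<^sup>+x. (SUP i. U i x) \<partial>L) = (SUP i. \<integral>\<^sup>+x. U i x \<partial>L)" if "sets L = sets borel" for L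
    using seq(4) that by (intro nn_integral_monotone_convergence_SUP)
      (auto simp: measurable_cong_sets[OF that refl])
  moreover have "incseq (\<lambda>i. \<integral>\<^sup>+x. U i x \<partial>L)" for L :: "real measure"
    using seq(4) by (auto simp: incseq_def le_fun_def intro!: nn_integral_mono)
  ultimately show ?case
    using seq(3) by (simp add: sets_M sets_N image_comp ennreal_SUP_add SUP_apply)
qed (simp_all add: nn_integral_cmult nn_integral_add distrib_left ac_simps cong: nn_integral_cong)

end

text \<open>The part of (II) from which the candidate measure \<open>glue\<close> is built. Both
  directions interpret it: one to show that \<open>glue\<close> realizes \<open>s\<close>, the other
  to identify a given \<open>\<mu>\<close> with \<open>glue\<close>.\<close>

locale reciprocal_profile =
  fixes s :: "ereal \<Rightarrow> ereal" and \<nu> :: "real measure"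
  assumes finite_borel: "finite_borel_measure \<nu>"
    and non_atomic: "non_atomic \<nu>"
    and s_0: "s 0 = 0"
    and antimono_s: "antimono_on {0..} s"
    and null_neg: "emeasure \<nu> {..<0} = 0"
    and gap_iff: "0 \<le> x \<Longrightarrow> x < y \<Longrightarrow> emeasure \<nu> (ereal -` {x<..<y}) = 0 \<longleftrightarrow> s x = s y"
begin

sublocale finite_borel_measure \<nu> by (rule finite_borel)

lemma sets_\<nu> [simp, measurable_cong]: "sets \<nu> = sets borel"
  by (rule M_is_borel)

lemma space_\<nu> [simp]: "space \<nu> = UNIV"
  using sets_eq_imp_space_eq[OF sets_\<nu>] by simp

lemma null_singleton: "emeasure \<nu> {x} = 0"
  by (intro non_atomic_emeasure_singleton non_atomic sets_\<nu>)

text \<open>The values of \<open>s\<close> at negative arguments are arbitrary; this constant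
  extension to the left is antitone everywhere, hence Borel.\<close>

definition \<sigma> :: "ereal \<Rightarrow> ereal" where "\<sigma> x = s (max 0 x)"

definition t :: "real \<Rightarrow> real" where "t x = real_of_ereal (\<sigma> (ereal x))"

lemma \<sigma>_nonneg: "0 \<le> x \<Longrightarrow> \<sigma> x = s x"
  by (simp add: \<sigma>_def max_absorb2)

lemma \<sigma>_nonpos_arg: "x \<le> 0 \<Longrightarrow> \<sigma> x = 0"
  by (simp add: \<sigma>_def max_absorb1 s_0)

lemma antimono_\<sigma>: "antimono \<sigma>"
  by (rule antimonoI) (auto simp: \<sigma>_def intro!: monotone_onD[OF antimono_s] max.mono)

lemma \<sigma>_nonpos: "\<sigma> x \<le> 0"
  using monotone_onD[OF antimono_s, of 0 "max 0 x"] by (simp add: \<sigma>_def s_0)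

lemma t_nonpos: "t x \<le> 0"
  using \<sigma>_nonpos[of "ereal x"] by (cases "\<sigma> (ereal x)") (auto simp: t_def)

lemma t_eq_0: "x \<le> 0 \<Longrightarrow> t x = 0"
  by (simp add: t_def \<sigma>_nonpos_arg)

lemma \<sigma>_measurable [measurable]: "\<sigma> \<in> borel_measurable borel"
  by (rule borel_measurable_antimono_ereal[OF antimono_\<sigma>])

lemma t_measurable [measurable]: "t \<in> borel_measurable borel"
  unfolding t_def by measurable

text \<open>Any two points of a level set of \<open>s\<close> bound a null gap by
  \<open>gap_iff\<close>. The values 0 and minus infinity give \<open>AE_t\<close>; a general real
  value excludes atoms of \<open>neg_side\<close>.\<close>

lemma AE_s_neq: "AE x in \<nu>. 0 < x \<longrightarrow> s (ereal x) \<noteq> c"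
proof -
  have "AE x in \<nu>. x \<notin> {x. 0 < x \<and> s (ereal x) = c}"
  proof (rule AE_not_in_gaps[OF sets_\<nu> null_singleton])
    fix x y assume "x \<in> {x. 0 < x \<and> s (ereal x) = c}" "y \<in> {x. 0 < x \<and> s (ereal x) = c}" "x < y"
    then have "emeasure \<nu> (ereal -` {ereal x<..<ereal y}) = 0" by (subst gap_iff) auto
    moreover have "ereal -` {ereal x<..<ereal y} = {x<..<y}" by auto
    ultimately show "emeasure \<nu> {x<..<y} = 0" by simp
  qed
  then show ?thesis by eventually_elim auto
qed

lemma AE_t: "AE x in \<nu>. 0 < x \<longrightarrow> t x < 0 \<and> ereal (t x) = \<sigma> (ereal x)"
  using AE_s_neq[of 0] AE_s_neq[of "- \<infinity>"]
proof eventually_elim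
  case (elim x)
  show ?case
  proof
    assume "0 < x"
    with elim show "t x < 0 \<and> ereal (t x) = \<sigma> (ereal x)"
      using \<sigma>_nonpos[of "ereal x"]
      by (cases "\<sigma> (ereal x)") (auto simp: t_def \<sigma>_nonneg less_le)
  qed
qed

lemma AE_pos: "AE x in \<nu>. 0 < x"
proof (rule AE_I')
  have "{..0::real} = {..<0} \<union> {0}" by auto
  moreover have "{..<0} \<union> {0} \<in> null_sets \<nu>"
    using null_neg null_singleton[of 0] by (intro null_sets.Un) (auto simp: null_sets_def)
  ultimately show "{..0} \<in> null_sets \<nu>" by simp
qed auto

text \<open>Where \<open>t x = 0\<close>, in particular where \<open>\<sigma> x\<close> is \<open>0\<close> or \<open>-\<infinity>\<close>, the weight below is \<open>0\<close>
  because \<open>- x / 0 = 0\<close>; by \<open>AE_t\<close> this matters only on a null set.\<close>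

definition neg_side :: "real measure" where
  "neg_side = distr (density \<nu> (\<lambda>x. ennreal (- x / t x))) borel t"

lemma sets_neg_side [simp, measurable_cong]: "sets neg_side = sets borel"
  and space_neg_side [simp]: "space neg_side = UNIV"
  by (simp_all add: neg_side_def)

lemma nn_integral_neg_side:
  assumes [measurable]: "f \<in> borel_measurable borel"
  shows "(\<integral>\<^sup>+y. f y \<partial>neg_side) = (\<integral>\<^sup>+x. ennreal (- x / t x) * f (t x) \<partial>\<nu>)"
  unfolding neg_side_def
  by (subst nn_integral_distr, measurable, subst nn_integral_density) auto

lemma emeasure_neg_side:
  assumes [measurable]: "A \<in> sets borel"
  shows "emeasure neg_side A = (\<integral>\<^sup>+x. ennreal (- x / t x) * indicator A (t x) \<partial>\<nu>)"
  by (subst nn_integral_neg_side[symmetric]) (auto simp: nn_integral_indicator)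

lemma emeasure_neg_side_nonneg:
  assumes "A \<subseteq> {0..}" "A \<in> sets borel"
  shows "emeasure neg_side A = 0"
proof -
  have "(\<integral>\<^sup>+x. ennreal (- x / t x) * indicator A (t x) \<partial>\<nu>) = (\<integral>\<^sup>+x. 0 \<partial>\<nu>)"
  proof (rule nn_integral_cong)
    fix x show "ennreal (- x / t x) * indicator A (t x) = 0"
      using assms(1) t_nonpos[of x] by (cases "t x = 0") (auto simp: indicator_def)
  qed
  then show ?thesis using assms(2) by (simp add: emeasure_neg_side)
qed

lemma emeasure_neg_side_singleton: "emeasure neg_side {y} = 0"
proof -
  have "(\<integral>\<^sup>+x. ennreal (- x / t x) * indicator {y} (t x) \<partial>\<nu>) = (\<integral>\<^sup>+x. 0 \<partial>\<nu>)"
  proof (rule nn_integral_cong_AE)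
    show "AE x in \<nu>. ennreal (- x / t x) * indicator {y} (t x) = 0"
      using AE_pos AE_t AE_s_neq[of "ereal y"]
      by eventually_elim (auto simp: indicator_def \<sigma>_nonneg)
  qed
  then show ?thesis by (simp add: emeasure_neg_side)
qed

text \<open>The weight \<open>- t x\<close> cancels the denominator of \<open>- x / t x\<close>,
  leaving \<open>x\<close> times \<open>\<nu>\<close> transported by
  \<open>\<sigma>\<close>.\<close>

lemma tilt_neg_side: "tilt uminus neg_side = distr (tilt (\<lambda>z. z) \<nu>) borel \<sigma>"
proof (rule measure_eqI)
  fix A assume "A \<in> sets (tilt uminus neg_side)"
  then have [measurable]: "A \<in> sets borel" by simp
  have vimage: "\<sigma> -` A \<in> sets borel"
    by (rule measurable_sets_borel[OF \<sigma>_measurable]) simp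
  have "emeasure (tilt uminus neg_side) A
      = (\<integral>\<^sup>+x. ennreal (- x / t x) * (ennreal (- t x) * indicator A (ereal (t x))) \<partial>\<nu>)"
    by (simp add: emeasure_tilt nn_integral_neg_side)
  also have "\<dots> = (\<integral>\<^sup>+x. ennreal x * indicator (\<sigma> -` A) (ereal x) \<partial>\<nu>)"
  proof (rule nn_integral_cong_AE)
    show "AE x in \<nu>. ennreal (- x / t x) * (ennreal (- t x) * indicator A (ereal (t x)))
        = ennreal x * indicator (\<sigma> -` A) (ereal x)"
      using AE_pos AE_t
    proof eventually_elim
      case (elim x)
      then have "ennreal (- x / t x) * ennreal (- t x) = ennreal x"
        by (subst ennreal_mult[symmetric]) (auto simp: divide_nonneg_neg)
      then show ?case using elim by (auto simp: indicator_def)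
    qed
  qed
  also have "\<dots> = emeasure (tilt (\<lambda>z. z) \<nu>) (\<sigma> -` A)"
    using vimage by (simp add: emeasure_tilt)
  also have "\<dots> = emeasure (distr (tilt (\<lambda>z. z) \<nu>) borel \<sigma>) A"
    by (simp add: emeasure_distr)
  finally show "emeasure (tilt uminus neg_side) A = emeasure (distr (tilt (\<lambda>z. z) \<nu>) borel \<sigma>) A" .
qed simp

definition glue :: "real measure" where "glue = add_measure \<nu> neg_side"

lemma sets_glue [simp, measurable_cong]: "sets glue = sets borel"
  and space_glue [simp]: "space glue = UNIV"
  by (simp_all add: glue_def)

lemma emeasure_glue: "A \<in> sets borel \<Longrightarrow> emeasure glue A = emeasure \<nu> A + emeasure neg_side A"
  by (simp add: glue_def emeasure_add_measure)

text \<open>The summand 1 integrates to the mass of \<open>\<nu>\<close>, the quotient to the mass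
  of \<open>neg_side\<close>.\<close>

lemma integral_condition:
  "(\<integral>\<^sup>+x\<in>{0<..}. e2ennreal (1 + neg_quot x (s (ereal x))) \<partial>\<nu>) = emeasure glue UNIV"
proof -
  have "(\<integral>\<^sup>+x\<in>{0<..}. e2ennreal (1 + neg_quot x (s (ereal x))) \<partial>\<nu>)
      = (\<integral>\<^sup>+x. 1 + ennreal (- x / t x) \<partial>\<nu>)"
  proof (rule nn_integral_cong_AE)
    show "AE x in \<nu>. e2ennreal (1 + neg_quot x (s (ereal x))) * indicator {0<..} x
        = 1 + ennreal (- x / t x)"
      using AE_pos AE_t
    proof eventually_elim
      case (elim x)
      then have s: "s (ereal x) = ereal (t x)" and neg: "t x < 0"
        by (auto simp: \<sigma>_nonneg)
      have "1 + neg_quot x (s (ereal x)) = ereal (1 + - x / t x)"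
        using neg unfolding s by (simp add: neg_quot_def one_ereal_def)
      also have "e2ennreal \<dots> = 1 + ennreal (- x / t x)"
        using neg elim by (subst e2ennreal_ereal, subst ennreal_plus) (auto simp: divide_nonneg_neg)
      finally show ?case using elim by simp
    qed
  qed
  also have "\<dots> = emeasure \<nu> UNIV + emeasure neg_side UNIV"
    by (subst nn_integral_add) (auto simp: emeasure_neg_side)
  finally show ?thesis by (simp add: emeasure_glue)
qed

lemma pos_part_glue: "pos_part glue = \<nu>"
proof (rule measure_eqI)
  fix A assume "A \<in> sets (pos_part glue)"
  then have A: "A \<in> sets borel" by simp
  have "emeasure \<nu> A = emeasure \<nu> (A \<inter> {0..})"
    using AE_pos A by (intro emeasure_eq_AE) (auto elim!: eventually_mono)
  with A show "emeasure (pos_part glue) A = emeasure \<nu> A"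
    by (simp add: emeasure_pos_part emeasure_glue emeasure_neg_side_nonneg)
qed simp

lemma tilt_pos_glue: "tilt (\<lambda>z. z) glue = tilt (\<lambda>z. z) \<nu>"
  using tilt_pos_part[OF sets_glue] by (simp add: pos_part_glue)

lemma tilt_neg_glue: "tilt uminus glue = distr (tilt (\<lambda>z. z) \<nu>) borel \<sigma>"
  unfolding tilt_neg_side[symmetric]
proof (rule measure_eqI)
  fix A assume "A \<in> sets (tilt uminus glue)"
  then have [measurable]: "A \<in> sets borel" by simp
  have "(\<integral>\<^sup>+z. ennreal (- z) * indicator A (ereal z) \<partial>\<nu>) = (\<integral>\<^sup>+z. 0 \<partial>\<nu>)"
    using AE_pos by (intro nn_integral_cong_AE) (auto elim!: eventually_mono simp: ennreal_neg)
  then show "emeasure (tilt uminus glue) A = emeasure (tilt uminus neg_side) A"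
    by (simp add: emeasure_tilt) (simp add: glue_def nn_integral_add_measure)
qed simp

lemma emeasure_tilt_neg_glue:
  "emeasure (tilt uminus glue) {y..} = emeasure (tilt (\<lambda>z. z) \<nu>) {x. y \<le> \<sigma> x}"
proof -
  have "\<sigma> -` {y..} = {x. y \<le> \<sigma> x}" by auto
  then show ?thesis by (simp add: tilt_neg_glue emeasure_distr)
qed

text \<open>The generalized inverse gives back \<open>s\<close>. The value \<open>s x\<close> itself
  is admissible by antitonicity. A larger admissible \<open>y\<close> would force the tilt of
  \<open>\<nu>\<close> to have no mass between the last point where \<open>s\<close> is at least
  \<open>y\<close> and \<open>x\<close>, whereas \<open>gap_iff\<close> gives it positive
  mass.\<close>

lemma s_eq_Sup:
  assumes left_cont: "\<And>x. 0 < x \<Longrightarrow> (s \<longlongrightarrow> s x) (at_left x)"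
    and fin: "emeasure (tilt (\<lambda>z. z) \<nu>) UNIV < \<infinity>" and x: "0 \<le> x"
  shows "Sup {y. y \<le> 0 \<and> emeasure (tilt (\<lambda>z. z) \<nu>) {..x} \<le> emeasure (tilt uminus glue) {y..}} = s x"
    (is "Sup ?S = _")
proof (rule Sup_eqI)
  let ?P = "tilt (\<lambda>z. z) \<nu>"
  fix y assume y: "y \<in> ?S"
  show "y \<le> s x"
  proof (rule ccontr)
    assume "\<not> y \<le> s x"
    then have less: "s x < y" by simp
    define D where "D = {z. 0 \<le> z \<and> z \<le> x \<and> y \<le> s z}"
    define q where "q = Sup D"
    have "0 \<in> D" using x y by (auto simp: D_def s_0)
    then have q0: "0 \<le> q" by (auto simp: q_def intro: Sup_upper)
    have qx: "q \<le> x" by (auto simp: q_def D_def intro: Sup_least)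
    \<comment> \<open>Left-continuity of \<open>s\<close> makes the supremum \<open>q\<close> a
      member of \<open>D\<close>.\<close>
    have q: "y \<le> s q"
    proof (rule ccontr)
      assume "\<not> y \<le> s q"
      then have sq: "s q < y" by simp
      with y have "q \<noteq> 0" by (auto simp: s_0)
      with q0 have "0 < q" by simp
      from order_tendstoD(2)[OF left_cont[OF this] sq] obtain b
        where b: "b < q" "\<And>z. b < z \<Longrightarrow> z < q \<Longrightarrow> s z < y"
        using eventually_at_left[OF \<open>0 < q\<close>] by auto
      then obtain d where d: "d \<in> D" "b < d" by (auto simp: q_def less_Sup_iff)
      then have "d \<le> q" by (auto simp: q_def intro: Sup_upper)
      with d sq have "d < q" by (auto simp: D_def less_le)
      with b(2)[of d] d show False by (auto simp: D_def)
    qed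
    with less qx have "q < x" by (auto simp: less_le)
    have "s q \<noteq> s x" using q less by auto
    then have "emeasure ?P {..q} \<noteq> emeasure ?P {..x}"
      using gap_iff[OF q0 \<open>q < x\<close>]
        emeasure_gap_eq_0_iff[OF sets_\<nu> null_singleton fin q0 \<open>q < x\<close>] by simp
    moreover have "emeasure ?P {..q} \<le> emeasure ?P {..x}"
      using qx by (intro emeasure_mono) auto
    ultimately have "emeasure ?P {..q} < emeasure ?P {..x}" by simp
    also have "\<dots> \<le> emeasure ?P {z. y \<le> \<sigma> z}"
      using y by (simp add: emeasure_tilt_neg_glue)
    also have "\<dots> \<le> emeasure ?P {..q}"
    proof (rule emeasure_mono)
      show "{z. y \<le> \<sigma> z} \<subseteq> {..q}"
      proof safe
        fix z assume z: "y \<le> \<sigma> z"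
        have "max 0 z \<le> x"
        proof (rule ccontr)
          assume "\<not> max 0 z \<le> x"
          then have "s (max 0 z) \<le> s x"
            using x by (intro monotone_onD[OF antimono_s]) auto
          with z less show False by (auto simp: \<sigma>_def)
        qed
        with z have "max 0 z \<in> D" by (auto simp: D_def \<sigma>_def)
        then have "max 0 z \<le> q" unfolding q_def by (rule Sup_upper)
        then show "z \<le> q" by simp
      qed
    qed simp
    finally show False by simp
  qed
next
  fix u assume u: "\<And>y. y \<in> ?S \<Longrightarrow> y \<le> u"
  have "{z. s x \<le> \<sigma> z} = \<sigma> -` {s x..}" by auto
  moreover have "\<sigma> -` {s x..} \<in> sets borel"
    by (rule measurable_sets_borel[OF \<sigma>_measurable]) simp
  moreover have "{..x} \<subseteq> {z. s x \<le> \<sigma> z}"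
    using antimonoD[OF antimono_\<sigma>, of _ x] x by (auto simp: \<sigma>_nonneg)
  ultimately have "emeasure (tilt (\<lambda>z. z) \<nu>) {..x} \<le> emeasure (tilt uminus glue) {s x..}"
    unfolding emeasure_tilt_neg_glue by (intro emeasure_mono) auto
  moreover have "s x \<le> 0" using \<sigma>_nonpos[of x] x by (simp add: \<sigma>_nonneg)
  ultimately show "s x \<le> u" by (intro u) auto
qed

lemma glue_realizes:
  assumes left_cont: "\<And>x. 0 < x \<Longrightarrow> (s \<longlongrightarrow> s x) (at_left x)"
    and fin: "G \<nu> \<infinity> < \<infinity>"
    and mass: "(\<integral>\<^sup>+x\<in>{0<..}. e2ennreal (1 + neg_quot x (s (ereal x))) \<partial>\<nu>) = 1"
  shows "recip_realizes glue s \<nu>"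
proof -
  have "{..\<infinity>} = (UNIV :: ereal set)" by auto
  then have fin': "emeasure (tilt (\<lambda>z. z) \<nu>) UNIV < \<infinity>"
    using fin by (simp add: G_nonneg)
  have "emeasure glue (space glue) = 1"
    using mass by (simp add: integral_condition)
  then interpret prob_space glue by (rule prob_spaceI)
  have "real_distribution glue" by standard simp
  moreover have "non_atomic glue"
    by (rule non_atomicI)
       (simp_all add: finite_measure_axioms emeasure_glue null_singleton emeasure_neg_side_singleton)
  \<comment> \<open>A pushforward preserves total mass, so the two tilted masses agree.\<close>
  moreover have "zero_mean glue"
    using fin' by (simp add: zero_mean_iff tilt_pos_glue tilt_neg_glue emeasure_distr)
  moreover have "recip glue x = s x" if "0 \<le> x" for x
  proof -
    have "recip glue x = Sup {y. y \<le> 0 \<and> emeasure (tilt (\<lambda>z. z) \<nu>) {..x} \<le> emeasure (tilt uminus glue) {y..}}"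
      using that by (simp add: recip_def x_minus_def G_nonneg tilt_pos_glue G_nonpos cong: conj_cong)
    also have "\<dots> = s x" by (rule s_eq_Sup[OF left_cont fin' that])
    finally show ?thesis .
  qed
  ultimately show ?thesis by (simp add: recip_realizes_def pos_part_glue)
qed

end

subsection \<open>Centered atomless distributions\<close>

locale centered_atomless = real_distribution \<mu> for \<mu> :: "real measure" +
  assumes non_atomic: "non_atomic \<mu>" and zero_mean: "zero_mean \<mu>"
begin

lemma null_singleton: "emeasure \<mu> {x} = 0"
  by (intro non_atomic_emeasure_singleton non_atomic) simp

lemma finite_tilt: "emeasure (tilt (\<lambda>z. z) \<mu>) UNIV < \<infinity>"
  and tilt_balanced: "emeasure (tilt uminus \<mu>) UNIV = emeasure (tilt (\<lambda>z. z) \<mu>) UNIV"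
  using zero_mean by (simp_all add: zero_mean_iff)

sublocale balanced_measures "tilt (\<lambda>z. z) \<mu>" "tilt uminus \<mu>"
proof -
  interpret P: atomless_ereal_measure "tilt (\<lambda>z. z) \<mu>"
    using finite_tilt by (intro atomless_tilt null_singleton) auto
  interpret N: atomless_ereal_measure "tilt uminus \<mu>"
    using finite_tilt tilt_balanced by (intro atomless_tilt null_singleton) auto
  have "(\<integral>\<^sup>+z. ennreal (- z) * indicator {0..} (ereal z) \<partial>\<mu>) = (\<integral>\<^sup>+z. 0 \<partial>\<mu>)"
    by (intro nn_integral_cong) (auto simp: indicator_def ennreal_neg)
  then show "balanced_measures (tilt (\<lambda>z. z) \<mu>) (tilt uminus \<mu>)"
    by unfold_locales (simp_all add: tilt_balanced emeasure_tilt)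
qed

lemma recip_eq_r: "0 \<le> x \<Longrightarrow> recip \<mu> x = r x"
  by (simp add: recip_def x_minus_def r_def G_nonneg G_nonpos cong: conj_cong)

lemma r_0: "r 0 = 0"
proof -
  have "(\<integral>\<^sup>+z. ennreal z * indicator {..0} (ereal z) \<partial>\<mu>) = (\<integral>\<^sup>+z. 0 \<partial>\<mu>)"
    by (intro nn_integral_cong) (auto simp: indicator_def ennreal_neg)
  then have "0 \<le> r 0" by (simp add: le_r_iff emeasure_tilt)
  then show ?thesis using r_nonpos[of 0] by simp
qed

text \<open>Expresses the negative part through \<open>r\<close> and the positive part alone, which
  is the source of uniqueness.\<close>

lemma emeasure_negative_part:
  assumes [measurable]: "A \<in> sets borel"
  shows "emeasure \<mu> (A \<inter> {..<0}) = (\<integral>\<^sup>+z. ennreal z *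
    (ennreal (- 1 / real_of_ereal (r (ereal z))) * indicator A (real_of_ereal (r (ereal z)))) \<partial>\<mu>)"
proof -
  \<comment> \<open>The factor \<open>- 1 / y\<close> undoes the weight of
    \<open>tilt uminus\<close>. At infinite \<open>y\<close> the conventions for
    \<open>real_of_ereal\<close> and division by 0 make \<open>g\<close> vanish.\<close>
  define g where "g y = ennreal (- 1 / real_of_ereal y) * indicator A (real_of_ereal y)" for y
  have [measurable]: "g \<in> borel_measurable borel" unfolding g_def by measurable
  have "emeasure \<mu> (A \<inter> {..<0}) = (\<integral>\<^sup>+z. indicator (A \<inter> {..<0}) z \<partial>\<mu>)"
    by simp
  also have "\<dots> = (\<integral>\<^sup>+z. ennreal (- z) * g (ereal z) \<partial>\<mu>)"
  proof (rule nn_integral_cong)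
    fix z :: real
    have "ennreal (- z) * ennreal (- 1 / z) = 1" if "z < 0"
      using that by (subst ennreal_mult[symmetric]) (auto simp: divide_nonpos_neg)
    then show "indicator (A \<inter> {..<0}) z = ennreal (- z) * g (ereal z)"
      by (auto simp: g_def indicator_def ennreal_neg)
  qed
  also have "\<dots> = (\<integral>\<^sup>+y. g y \<partial>tilt uminus \<mu>)"
    by (simp add: nn_integral_tilt)
  also have "\<dots> = (\<integral>\<^sup>+y. g y \<partial>distr (tilt (\<lambda>z. z) \<mu>) borel r)"
    by (simp add: distr_r)
  also have "\<dots> = (\<integral>\<^sup>+y. g (r y) \<partial>tilt (\<lambda>z. z) \<mu>)"
    by (rule nn_integral_distr) auto
  also have "\<dots> = (\<integral>\<^sup>+z. ennreal z * g (r (ereal z)) \<partial>\<mu>)"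
    by (rule nn_integral_tilt) auto
  finally show ?thesis by (simp add: g_def)
qed

end

text \<open>Both conclusions are proved together, because the integral condition is read off from
  the total mass of \<open>glue\<close> after \<open>\<mu>\<close> has been identified with
  it.\<close>

lemma recip_realizes_imp:
  assumes "finite_borel_measure \<nu>" "non_atomic \<nu>" and realizes: "recip_realizes \<mu> s \<nu>"
  shows "recip_conditions s \<nu>" and "\<mu> = reciprocal_profile.glue s \<nu>"
proof -
  interpret real_distribution \<mu> using realizes by (simp add: recip_realizes_def)
  interpret \<mu>: centered_atomless \<mu>
    by unfold_locales (use realizes in \<open>simp_all add: recip_realizes_def\<close>)
  let ?P = "tilt (\<lambda>z. z) \<nu>" and ?N = "tilt uminus \<mu>"
  have \<nu>: "\<nu> = pos_part \<mu>" and "\<And>x. 0 \<le> x \<Longrightarrow> recip \<mu> x = s x"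
    using realizes by (auto simp: recip_realizes_def)
  then have s: "s x = \<mu>.r x" if "0 \<le> x" for x
    using \<mu>.recip_eq_r[OF that] that by simp
  have sets_\<nu> [simp]: "sets \<nu> = sets borel" by (simp add: \<nu>)
  have P: "tilt (\<lambda>z. z) \<mu> = ?P" by (simp add: \<nu> tilt_pos_part)
  then have P': "emeasure (tilt (\<lambda>z. z) \<mu>) A = emeasure ?P A" for A by simp
  have fin: "emeasure ?P UNIV < \<infinity>" using \<mu>.finite_tilt by (simp add: P')
  have UNIV: "{..\<infinity>} = (UNIV :: ereal set)" "{- \<infinity>..} = (UNIV :: ereal set)" by auto
  have G: "G \<nu> x = emeasure ?P {..x}" if "0 \<le> x" for x
    using that by (simp add: G_nonneg)
  have gap: "emeasure \<nu> (ereal -` {x<..<y}) = 0 \<longleftrightarrow> s x = s y" if "0 \<le> x" "x < y" for x y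
  proof -
    have "emeasure \<nu> (ereal -` {x<..<y}) = 0 \<longleftrightarrow> emeasure ?P {..x} = emeasure ?P {..y}"
      using that fin assms(2)
      by (intro emeasure_gap_eq_0_iff non_atomic_emeasure_singleton) auto
    also have "\<dots> \<longleftrightarrow> s x = s y"
      using that s[of y] by (simp add: s \<mu>.r_eq_iff P')
    finally show ?thesis .
  qed
  have s0: "s 0 = 0" by (simp add: s \<mu>.r_0)
  have anti: "antimono_on {0..} s"
    by (rule monotone_onI) (use s antimonoD[OF \<mu>.antimono_r] in auto)
  have neg: "emeasure \<nu> {..<0} = 0"
  proof -
    have "{..<0} \<inter> {0::real..} = {}" by auto
    then show ?thesis by (simp add: \<nu> emeasure_pos_part)
  qed
  \<comment> \<open>This makes \<open>glue\<close> available while the integral condition is still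
    open.\<close>
  interpret reciprocal_profile s \<nu>
    by (rule reciprocal_profile.intro) (fact assms s0 anti neg gap)+
  have left_cont: "(s \<longlongrightarrow> s x) (at_left x)" if "0 < x" for x
  proof -
    have "eventually (\<lambda>z. \<mu>.r z = s z) (at_left x)"
      using that by (intro eventually_at_leftI[of 0]) (auto simp: s)
    moreover have "(\<mu>.r \<longlongrightarrow> s x) (at_left x)"
      using \<mu>.r_left_continuous[of x] that by (simp add: s)
    ultimately show ?thesis by (simp add: tendsto_cong)
  qed
  have bounded: "s x > - \<infinity>" if "0 \<le> x" "G \<nu> x < G \<nu> \<infinity>" for x
  proof (rule ccontr)
    assume "\<not> s x > - \<infinity>"
    \<comment> \<open>Then \<open>{r x..}\<close> is the whole line, so \<open>{..x}\<close> already
      carries the full mass of \<open>?P\<close>.\<close>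
    then have "\<mu>.r x = - \<infinity>" using that by (simp add: s)
    then have "emeasure ?P {..x} = emeasure ?P UNIV"
      using \<mu>.emeasure_N_atLeast_r[of x] \<mu>.tilt_balanced by (simp add: UNIV P')
    with that show False by (simp add: G UNIV)
  qed
  have negative: "s x < 0" if "x > 0" "G \<nu> x > 0" for x
  proof (rule ccontr)
    assume "\<not> s x < 0"
    then have "\<mu>.r x = 0" using that \<mu>.r_nonpos[of x] by (simp add: s)
    then have "emeasure ?P {..x} = 0"
      using \<mu>.emeasure_N_atLeast_r[of x] \<mu>.N_nonneg by (simp add: P')
    with that show False by (simp add: G)
  qed
  show glue: "\<mu> = glue"
  proof (rule measure_eqI)
    fix A assume "A \<in> sets \<mu>"
    then have A [measurable]: "A \<in> sets borel" by simp
    have [measurable]: "\<mu>.r \<in> borel_measurable borel" by (rule \<mu>.r_measurable)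
    let ?g = "\<lambda>y. ennreal (- 1 / y) * indicator A y"
    have "emeasure \<mu> (A \<inter> {..<0})
        = (\<integral>\<^sup>+z. ennreal z * ?g (real_of_ereal (\<mu>.r (ereal z))) \<partial>\<mu>)"
      by (rule \<mu>.emeasure_negative_part) simp
    also have "\<dots> = (\<integral>\<^sup>+y. ?g (real_of_ereal (\<mu>.r y)) \<partial>?P)"
      unfolding P[symmetric] by (subst nn_integral_tilt) auto
    also have "\<dots> = (\<integral>\<^sup>+z. ennreal z * ?g (real_of_ereal (\<mu>.r (ereal z))) \<partial>\<nu>)"
      by (subst nn_integral_tilt) auto
    also have "\<dots> = (\<integral>\<^sup>+z. ennreal (- z / t z) * indicator A (t z) \<partial>\<nu>)"
    \<comment> \<open>The integrands agree at every point: for \<open>z \<le> 0\<close> both vanish,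
      and where \<open>t z = 0\<close> division by 0 makes both 0.\<close>
    proof (rule nn_integral_cong)
      fix z
      show "ennreal z * ?g (real_of_ereal (\<mu>.r (ereal z))) = ennreal (- z / t z) * indicator A (t z)"
      proof (cases "0 < z")
        case True
        then have "real_of_ereal (\<mu>.r (ereal z)) = t z"
          by (simp add: t_def \<sigma>_nonneg s)
        moreover have "ennreal z * ennreal (- 1 / t z) = ennreal (- z / t z)"
          using True t_nonpos[of z]
          by (subst ennreal_mult[symmetric]) (auto simp: divide_nonpos_nonpos)
        ultimately show ?thesis by (simp flip: mult.assoc)
      qed (simp add: ennreal_neg t_eq_0)
    qed
    also have "\<dots> = emeasure neg_side A" by (simp add: emeasure_neg_side)
    finally have "emeasure \<mu> (A \<inter> {..<0}) = emeasure neg_side A" .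
    moreover have "emeasure \<mu> A = emeasure \<mu> (A \<inter> {0..}) + emeasure \<mu> (A \<inter> {..<0})"
    proof -
      have "A = (A \<inter> {0..}) \<union> (A \<inter> {..<0})" by auto
      then show ?thesis by (subst plus_emeasure) auto
    qed
    moreover have "emeasure \<nu> A = emeasure \<mu> (A \<inter> {0..})"
      by (simp add: \<nu> emeasure_pos_part)
    ultimately show "emeasure \<mu> A = emeasure glue A" by (simp add: emeasure_glue)
  qed simp
  have "emeasure glue UNIV = 1" using emeasure_space_1 glue by simp
  then have "(\<integral>\<^sup>+x\<in>{0<..}. e2ennreal (1 + neg_quot x (s (ereal x))) \<partial>\<nu>) = 1"
    by (simp add: integral_condition)
  then show "recip_conditions s \<nu>"
    using s0 anti left_cont neg fin bounded negative gap
    by (auto simp: recip_conditions_def G UNIV)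
qed

lemma reciprocal_profileI:
  assumes "finite_borel_measure \<nu>" "non_atomic \<nu>" "recip_conditions s \<nu>"
  shows "reciprocal_profile s \<nu>"
  using assms(3) unfolding recip_conditions_def
  by (intro reciprocal_profile.intro assms(1,2)) blast+

theorem proposition3p31:
  fixes s :: "ereal \<Rightarrow> ereal" and \<nu> :: "real measure"
  assumes "finite_borel_measure \<nu>" and "non_atomic \<nu>"
  shows "((\<exists>\<mu>. recip_realizes \<mu> s \<nu>) \<longleftrightarrow> recip_conditions s \<nu>) \<and>
         (recip_conditions s \<nu> \<longrightarrow> (\<exists>!\<mu>. recip_realizes \<mu> s \<nu>))"
proof -
  have "recip_realizes (reciprocal_profile.glue s \<nu>) s \<nu>" if "recip_conditions s \<nu>"
    using reciprocal_profileI[OF assms that] that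
    by (intro reciprocal_profile.glue_realizes) (auto simp: recip_conditions_def)
  then show ?thesis
    using recip_realizes_imp[OF assms] by blast
qed

end
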